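(* Let $m$ be an infinite cardinal and let $T$ be a rayless tree with motion $m$ and $\Delta(T)\le 2^m$. Then $a(T)=2^{|T|}$.
   Context: A rayless tree is one containing no one-way infinite path. $\Delta(T)$ is the least upper bound of the vertex degrees of $T$. The motion of a graph is the least number of vertices moved by a non-identity automorphism; by convention an asymmetric graph has motion larger than every cardinal. A set $S\subseteq V(T)$ is asymmetrizing if the identity is the only automorphism of $T$ mapping $S$ onto itself; two asymmetrizing sets $S,S'$ are equivalent if some automorphism $\varphi$ of $T$ has $\varphi(S)=S'$; $a(T)$ is the number of pairwise inequivalent asymmetrizing sets of $T$. *)

theory Defs
  imports Main "HOL-Combinatorics.Permutations"
begin

unbundle cardinal_syntax

text \<open>A graph is a vertex set \<open>V\<close> with a symmetric irreflexive adjacency relation \<open>E\<close> on \<open>V\<close>.\<close>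

definition simple_graph :: "'a set \<Rightarrow> 'a rel \<Rightarrow> bool" where
  "simple_graph V E \<longleftrightarrow> E \<subseteq> V \<times> V \<and> sym E \<and> irrefl E"

definition connected_graph :: "'a set \<Rightarrow> 'a rel \<Rightarrow> bool" where
  "connected_graph V E \<longleftrightarrow> V \<noteq> {} \<and> (\<forall>u\<in>V. \<forall>v\<in>V. (u, v) \<in> E\<^sup>*)"

definition is_cycle :: "'a rel \<Rightarrow> 'a list \<Rightarrow> bool" where
  "is_cycle E xs \<longleftrightarrow> 3 \<le> length xs \<and> distinct xs \<and>
     (\<forall>i. Suc i < length xs \<longrightarrow> (xs ! i, xs ! Suc i) \<in> E) \<and> (last xs, hd xs) \<in> E"

definition is_tree :: "'a set \<Rightarrow> 'a rel \<Rightarrow> bool" where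
  "is_tree V E \<longleftrightarrow> simple_graph V E \<and> connected_graph V E \<and> \<not> (\<exists>xs. is_cycle E xs)"

definition is_ray :: "'a rel \<Rightarrow> (nat \<Rightarrow> 'a) \<Rightarrow> bool" where
  "is_ray E r \<longleftrightarrow> inj r \<and> (\<forall>n. (r n, r (Suc n)) \<in> E)"

definition rayless_tree :: "'a set \<Rightarrow> 'a rel \<Rightarrow> bool" where
  "rayless_tree V E \<longleftrightarrow> is_tree V E \<and> \<not> (\<exists>r. is_ray E r)"

text \<open>The supremum of the vertex degrees as a cardinal. It is chosen among cardinals on the
  vertex type; lemmas \<open>sup_degree_upper\<close> and \<open>sup_degree_least\<close> below show that it is the least
  upper bound among the cardinals on all types. The degree of \<open>v\<close> is the cardinal \<open>|E `` {v}|\<close>.\<close>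

definition degree_bound :: "'a set \<Rightarrow> 'a rel \<Rightarrow> 'b rel \<Rightarrow> bool" where
  "degree_bound V E k \<longleftrightarrow> Card_order k \<and> (\<forall>v\<in>V. |E `` {v}| \<le>o k)"

definition sup_degree :: "'a set \<Rightarrow> 'a rel \<Rightarrow> 'a rel" where
  "sup_degree V E =
     (SOME k. degree_bound V E k \<and> (\<forall>k' :: 'a rel. degree_bound V E k' \<longrightarrow> k \<le>o k'))"

lemma sup_degree_spec:
  fixes E :: "'a rel"
  shows "degree_bound V E (sup_degree V E) \<and>
         (\<forall>k' :: 'a rel. degree_bound V E k' \<longrightarrow> sup_degree V E \<le>o k')"
proof -
  let ?R = "{k :: 'a rel. degree_bound V E k}"
  have "|UNIV :: 'a set| \<in> ?R"
    by (simp add: degree_bound_def card_of_mono1 card_of_Card_order del: Field_card_of)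
  then have "?R \<noteq> {}" by blast
  moreover have "\<forall>k\<in>?R. Card_order k"
    by (simp add: degree_bound_def)
  ultimately have "\<exists>k\<in>?R. \<forall>k'\<in>?R. k \<le>o k'"
    by (rule exists_minim_Card_order)
  then have "\<exists>k :: 'a rel. degree_bound V E k \<and> (\<forall>k' :: 'a rel. degree_bound V E k' \<longrightarrow> k \<le>o k')"
    by blast
  then show ?thesis
    unfolding sup_degree_def by (rule someI_ex)
qed

lemma sup_degree_upper: "degree_bound V E (sup_degree V E)"
  using sup_degree_spec by blast

lemma sup_degree_least:
  fixes E :: "'a rel" and k :: "'b rel"
  assumes k: "degree_bound V E k"
  shows "sup_degree V E \<le>o k"
proof -
  have Ck: "Card_order k" using k by (simp add: degree_bound_def)
  have univ_bound: "degree_bound V E |UNIV :: 'a set|"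
    by (simp add: degree_bound_def card_of_mono1 card_of_Card_order del: Field_card_of)
  have UB: "sup_degree V E \<le>o |UNIV :: 'a set|"
    using sup_degree_spec[of V E] univ_bound by blast
  consider "|UNIV :: 'a set| \<le>o |Field k|" | "|Field k| \<le>o |UNIV :: 'a set|"
    using ordLeq_total[OF card_of_Well_order card_of_Well_order] by blast
  then show ?thesis
  proof cases
    case 1
    then show ?thesis
      using UB ordLeq_transitive ordLeq_ordIso_trans card_of_Field_ordIso[OF Ck] by blast
  next
    case 2
    then obtain f :: "'b \<Rightarrow> 'a" where "inj_on f (Field k)"
      unfolding card_of_ordLeq[symmetric] by blast
    then have "bij_betw f (Field k) (f ` Field k)"
      by (simp add: bij_betw_imageI)
    then have "|Field k| =o |f ` Field k|"
      using card_of_ordIso by blast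
    then have iso: "k =o |f ` Field k|"
      using card_of_Field_ordIso[OF Ck] ordIso_symmetric ordIso_transitive by blast
    then have "degree_bound V E |f ` Field k|"
      using k ordLeq_ordIso_trans unfolding degree_bound_def
      by (meson card_of_Card_order)
    then have "sup_degree V E \<le>o |f ` Field k|"
      using sup_degree_spec by blast
    then show ?thesis
      using iso ordIso_symmetric ordLeq_ordIso_trans by blast
  qed
qed

text \<open>Automorphisms are permutations of the vertex type that are the identity outside \<open>V\<close>, so that
  the identity automorphism is literally \<^term>\<open>id\<close>.\<close>

definition automorphisms :: "'a set \<Rightarrow> 'a rel \<Rightarrow> ('a \<Rightarrow> 'a) set" where
  "automorphisms V E =
     {f. f permutes V \<and> (\<forall>u\<in>V. \<forall>v\<in>V. (f u, f v) \<in> E \<longleftrightarrow> (u, v) \<in> E)}"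

text \<open>The motion as a relation: an asymmetric graph is in relation to no cardinal, in line with
  the convention that its motion exceeds every cardinal.\<close>

definition has_motion :: "'a set \<Rightarrow> 'a rel \<Rightarrow> 'b rel \<Rightarrow> bool" where
  "has_motion V E m \<longleftrightarrow>
     (\<exists>f \<in> automorphisms V E - {id}. |{v \<in> V. f v \<noteq> v}| =o m) \<and>
     (\<forall>f \<in> automorphisms V E - {id}. m \<le>o |{v \<in> V. f v \<noteq> v}| )"

definition asymmetrizing_sets :: "'a set \<Rightarrow> 'a rel \<Rightarrow> 'a set set" where
  "asymmetrizing_sets V E = {S. S \<subseteq> V \<and> (\<forall>f \<in> automorphisms V E. f ` S = S \<longrightarrow> f = id)}"

definition asymmetrizing_equiv :: "'a set \<Rightarrow> 'a rel \<Rightarrow> 'a set rel" where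
  "asymmetrizing_equiv V E =
     {(S, S'). S \<in> asymmetrizing_sets V E \<and> S' \<in> asymmetrizing_sets V E \<and>
               (\<exists>f \<in> automorphisms V E. f ` S = S')}"

definition num_asymmetrizing :: "'a set \<Rightarrow> 'a rel \<Rightarrow> 'a set set rel" where
  "num_asymmetrizing V E = |asymmetrizing_sets V E // asymmetrizing_equiv V E|"

end

theory Submission
  imports Defs
begin

text \<open>
  Comparing the ordinal ranks of the two branches at each edge shows that a rayless tree has a
  center, a vertex \<open>c\<close> or an edge \<open>{c, d}\<close> preserved by all automorphisms. Root the tree at \<open>c\<close>.
  Since there are no rays, the branches are well-founded, and by induction every branch \<open>B\<close> has
  \<open>2^|B|\<close> inequivalent asymmetrizing sets: if a vertex has two isomorphic child branches, then
  swapping them is an automorphism, hence these branches have at least \<open>m\<close> vertices and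
  there are at most \<open>2^m\<close> of them, few enough to equip them with pairwise inequivalent sets while
  retaining all the freedom of choice. Putting \<open>c\<close> into and \<open>d\<close> out of the resulting sets rules out
  automorphisms that move \<open>c\<close> and merges at most four sets into one.
\<close>

locale rayless =
  fixes V :: "'a set" and E :: "'a rel"
  assumes rayless: "rayless_tree V E"
begin

lemma edge_in: "(x, y) \<in> E \<Longrightarrow> x \<in> V \<and> y \<in> V"
  and edge_sym: "(x, y) \<in> E \<Longrightarrow> (y, x) \<in> E"
  and edge_irrefl: "(x, x) \<notin> E"
  and acyclic: "\<not> is_cycle E xs"
  and no_ray: "\<not> is_ray E r"
  and connected: "x \<in> V \<Longrightarrow> y \<in> V \<Longrightarrow> (x, y) \<in> E\<^sup>*"
  and nonempty: "V \<noteq> {}"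
  using rayless
  by (auto simp: rayless_tree_def is_tree_def simple_graph_def connected_graph_def sym_def irrefl_def)

subsection \<open>Non-backtracking walks\<close>

text \<open>A closest repetition closes up: distances one and two are excluded by irreflexivity and
  by not backtracking, and otherwise the vertices in between form a cycle.\<close>

lemma walk_inj:
  assumes edge: "\<And>n. n < N \<Longrightarrow> (r n, r (Suc n)) \<in> E"
    and nb: "\<And>n. Suc (Suc n) \<le> N \<Longrightarrow> r (Suc (Suc n)) \<noteq> r n"
    and "i < j" "j \<le> N"
  shows "r i \<noteq> r j"
  using assms(3,4)
proof (induction "j - i" arbitrary: i j rule: less_induct)
  case less
  show ?case
  proof
    assume eq: "r i = r j"
    have "j \<noteq> Suc i" using edge[of i] eq edge_irrefl less.prems by auto
    moreover have "j \<noteq> Suc (Suc i)" using nb[of i] eq less.prems by auto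
    ultimately have j: "i + 3 \<le> j" using less.prems by linarith
    have ne: "r a \<noteq> r b" if "i \<le> a" "a < b" "b < j" for a b
      using less.hyps[of b a] that less.prems by linarith
    have "inj_on r {i..<j}"
    proof (rule inj_onI)
      fix a b assume "a \<in> {i..<j}" "b \<in> {i..<j}" "r a = r b"
      then show "a = b"
        using ne[of a b] ne[of b a] by (metis atLeastLessThan_iff linorder_neqE_nat)
    qed
    moreover have "(r (i + k), r (Suc (i + k))) \<in> E" if "Suc k < j - i" for k
      using edge[of "i + k"] that less.prems by simp
    moreover have "(r (j - 1), r i) \<in> E"
      using edge[of "j - 1"] eq j less.prems by simp
    ultimately have "is_cycle E (map r [i..<j])"
      using j unfolding is_cycle_def by (auto simp: distinct_map last_map hd_map nth_append)
    then show False using acyclic by blast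
  qed
qed

text \<open>The form in which raylessness is used, both for well-foundedness of the branches and for
  the existence of a center.\<close>

lemma no_infinite_walk:
  assumes edge: "\<And>n. (r n, r (Suc n)) \<in> E"
    and nb: "\<And>n. r (Suc (Suc n)) \<noteq> r n"
  shows False
proof -
  have "r i \<noteq> r j" if "i < j" for i j
    using walk_inj[where r = r, OF edge nb that order.refl] by simp
  then have "inj r"
    by (metis injI linorder_neqE_nat)
  then show False
    using edge no_ray unfolding is_ray_def by blast
qed

subsection \<open>Branches\<close>

text \<open>\<open>in_branch u v x\<close>: some non-backtracking walk from \<open>v\<close> to \<open>x\<close> does not start with the
  step to \<open>u\<close>. For \<open>u = v\<close> there is no restriction, and the branch is the whole tree.\<close>

inductive in_branch :: "'a \<Rightarrow> 'a \<Rightarrow> 'a \<Rightarrow> bool" where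
  tip: "in_branch u v v"
| step: "(v, w) \<in> E \<Longrightarrow> w \<noteq> u \<Longrightarrow> in_branch v w x \<Longrightarrow> in_branch u v x"

definition branch :: "'a \<Rightarrow> 'a \<Rightarrow> 'a set" where
  "branch u v = {x. in_branch u v x}"

definition children :: "'a \<Rightarrow> 'a \<Rightarrow> 'a set" where
  "children u v = {w. (v, w) \<in> E \<and> w \<noteq> u}"

text \<open>A pair \<open>(u, v)\<close> stands for the branch at \<open>v\<close> seen from
  \<open>u\<close>. The child comes first, as \<open>wf\<close> demands.\<close>

definition child_rel :: "('a \<times> 'a) rel" where
  "child_rel = {((v, w), (u, v)) |u v w. w \<in> children u v}"

lemma child_relI: "w \<in> children u v \<Longrightarrow> ((v, w), (u, v)) \<in> child_rel"
  by (auto simp: child_rel_def)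

lemma wf_child_rel: "wf child_rel"
  unfolding wf_iff_no_infinite_down_chain
proof
  assume "\<exists>p. \<forall>n. (p (Suc n), p n) \<in> child_rel"
  then obtain p where p: "\<And>n. (p (Suc n), p n) \<in> child_rel" by blast
  have p': "fst (p (Suc n)) = snd (p n)" "(snd (p n), snd (p (Suc n))) \<in> E"
    "snd (p (Suc n)) \<noteq> fst (p n)" for n
    using p[of n] by (auto simp: child_rel_def children_def)
  show False
    by (rule no_infinite_walk[of "\<lambda>n. snd (p n)"]) (use p' in metis)+
qed

lemma branch_unfold: "branch u v = insert v (\<Union>w\<in>children u v. branch v w)"
  unfolding branch_def children_def
  by (auto intro: in_branch.intros elim: in_branch.cases)

lemma tip_in_branch: "v \<in> branch u v"
  by (simp add: branch_def tip)

lemma child_branch_subset: "w \<in> children u v \<Longrightarrow> branch v w \<subseteq> branch u v"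
  using branch_unfold by blast

lemma children_subset_branch: "children u v \<subseteq> branch u v"
  using child_branch_subset tip_in_branch by blast

text \<open>An edge leaving a child branch leads back to the tip \<open>v\<close>, which is still
  inside. So only the tip itself has a way out, namely to \<open>u\<close>.\<close>

lemma branch_exit:
  assumes "x \<in> branch u v" "(x, y) \<in> E" "y \<notin> branch u v"
  shows "x = v \<and> y = u"
proof -
  have "in_branch u v x \<Longrightarrow> (x, y) \<in> E \<Longrightarrow> y \<notin> branch u v \<Longrightarrow> x = v \<and> y = u"
  proof (induction rule: in_branch.induct)
    case (tip u v)
    then show ?case
      using children_subset_branch[of u v] by (auto simp: children_def)
  next
    case (step v w u x)
    then have "branch v w \<subseteq> branch u v"
      by (simp add: child_branch_subset children_def)
    with step tip_in_branch[of v u] show ?case by blast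
  qed
  then show ?thesis using assms by (simp add: branch_def)
qed

text \<open>For \<open>u = v\<close> the exit found in \<open>branch_exit\<close> would end in the
  tip, so nothing leaves the branch and connectedness fills it up.\<close>

lemma branch_self: assumes "c \<in> V" shows "branch c c = V"
proof
  have "in_branch u v x \<Longrightarrow> v \<in> V \<Longrightarrow> x \<in> V" for u v x
    by (induction rule: in_branch.induct) (use edge_in in blast)+
  then show "branch c c \<subseteq> V" using assms by (auto simp: branch_def)
next
  show "V \<subseteq> branch c c"
  proof
    fix x assume "x \<in> V"
    then have "(c, x) \<in> E\<^sup>*" using connected assms by blast
    then show "x \<in> branch c c"
    proof induction
      case base
      then show ?case by (rule tip_in_branch)
    next
      case (step y z)
      then show ?case using branch_exit tip_in_branch by metis
    qed
  qed
qed

lemma branch_subset: "v \<in> V \<Longrightarrow> branch u v \<subseteq> V"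
  using branch_self[of v] child_branch_subset[of _ v v] edge_irrefl
  by (subst branch_unfold) (fastforce simp: children_def)

text \<open>A walk from \<open>v\<close> to \<open>u\<close> in the branch, preceded by the step
  from \<open>u\<close> to \<open>v\<close>, would be a non-backtracking walk returning to its
  start.\<close>

lemma stem_notin_branch:
  assumes "(u, v) \<in> E"
  shows "u \<notin> branch u v"
proof
  have walk: "in_branch u v x \<Longrightarrow> (u, v) \<in> E \<Longrightarrow>
    \<exists>r N. 0 < N \<and> r 0 = u \<and> r 1 = v \<and> r N = x \<and> (\<forall>n<N. (r n, r (Suc n)) \<in> E) \<and>
      (\<forall>n. Suc (Suc n) \<le> N \<longrightarrow> r (Suc (Suc n)) \<noteq> r n)" for u v x
  proof (induction rule: in_branch.induct)
    case (tip u v)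
    then show ?case
      by (intro exI[of _ "\<lambda>n. if n = 0 then u else v"] exI[of _ 1]) auto
  next
    case (step v w u x)
    then obtain r N where r: "0 < N" "r 0 = v" "r 1 = w" "r N = x"
      "\<forall>n<N. (r n, r (Suc n)) \<in> E" "\<forall>n. Suc (Suc n) \<le> N \<longrightarrow> r (Suc (Suc n)) \<noteq> r n"
      by blast
    show ?case
      using r step.hyps step.prems
      by (intro exI[of _ "case_nat u r"] exI[of _ "Suc N"])
        (auto split: nat.split)
  qed
  assume "u \<in> branch u v"
  with assms walk obtain r N where "0 < N" "r 0 = u" "r N = u"
    "\<forall>n<N. (r n, r (Suc n)) \<in> E" "\<forall>n. Suc (Suc n) \<le> N \<longrightarrow> r (Suc (Suc n)) \<noteq> r n"
    unfolding branch_def by blast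
  then show False using walk_inj[of N r 0 N] by auto
qed

text \<open>By \<open>branch_exit\<close>, the branch at \<open>w'\<close> can only be entered along
  the edge from \<open>v\<close> to \<open>w'\<close>. A walk inside the branch at \<open>w\<close>
  never meets \<open>v\<close>. The induction generalizes \<open>v\<close>, \<open>w\<close> to any
  \<open>s\<close>, \<open>t\<close> whose branch avoids \<open>v\<close>.\<close>

lemma sibling_branches_disjoint:
  assumes "(v, w) \<in> E" "(v, w') \<in> E" "w \<noteq> w'"
  shows "branch v w \<inter> branch v w' = {}"
proof -
  have v: "v \<notin> branch v w'" using assms stem_notin_branch by blast
  have "in_branch s t x \<Longrightarrow> (s, t) \<in> E \<Longrightarrow> v \<notin> branch s t \<Longrightarrow> s \<notin> branch v w' \<Longrightarrow>
    x \<in> branch v w' \<Longrightarrow> s = v \<and> t = w'" for s t x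
  proof (induction rule: in_branch.induct)
    case (tip s t)
    then show ?case using branch_exit edge_sym by blast
  next
    case (step t t' s x)
    have sub: "branch t t' \<subseteq> branch s t"
      using step by (simp add: child_branch_subset children_def)
    show ?case
    proof (cases "t \<in> branch v w'")
      case True
      then show ?thesis using branch_exit edge_sym step.prems by blast
    next
      case False
      then have "t = v" using step sub by blast
      then show ?thesis using step.prems tip_in_branch by blast
    qed
  qed
  from this[of v w] show ?thesis
    using assms v stem_notin_branch[of v w] by (auto simp: branch_def)
qed

subsection \<open>The center\<close>

text \<open>The simulation order on branches. As the child relation is well-founded, it compares the
  ordinal ranks of branches without mentioning ordinals.\<close>

inductive le :: "'a \<times> 'a \<Rightarrow> 'a \<times> 'a \<Rightarrow> bool" where
  leI: "(\<And>s'. (s', s) \<in> child_rel \<Longrightarrow> \<exists>t'. (t', t) \<in> child_rel \<and> le s' t') \<Longrightarrow> le s t"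

lemma leD: "le s t \<Longrightarrow> (s', s) \<in> child_rel \<Longrightarrow> \<exists>t'. (t', t) \<in> child_rel \<and> le s' t'"
  by (erule le.cases) blast

lemma le_trans: "le s t \<Longrightarrow> le t q \<Longrightarrow> le s q"
proof (induction arbitrary: q rule: le.induct)
  case (leI s t)
  then show ?case by (meson le.leI leD)
qed

lemma le_child: "(s', s) \<in> child_rel \<Longrightarrow> le s' s"
proof (induction s' arbitrary: s rule: wf_induct_rule[OF wf_child_rel])
  case (1 s')
  then show ?case by (meson le.leI)
qed

text \<open>If \<open>s\<close> were simulated by its child \<open>s'\<close>, then
  \<open>s'\<close> would be simulated by one of its own children, and so on, against
  well-foundedness.\<close>

lemma not_le_child: "(s', s) \<in> child_rel \<Longrightarrow> \<not> le s s'"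
proof (induction s arbitrary: s' rule: wf_induct_rule[OF wf_child_rel])
  case (1 s)
  then show ?case by (meson leD)
qed

text \<open>If \<open>s\<close> is not below \<open>t\<close>, some child \<open>s'\<close> of
  \<open>s\<close> is below no child of \<open>t\<close>. By induction every child of
  \<open>t\<close> is below a child of \<open>s'\<close>, hence \<open>t\<close> is below
  \<open>s'\<close>.\<close>

lemma le_total: "le s t \<or> le t s"
proof -
  have "\<not> le s t \<Longrightarrow> \<exists>s'. (s', s) \<in> child_rel \<and> le t s'"
  proof (induction s arbitrary: t rule: wf_induct_rule[OF wf_child_rel])
    case (1 s)
    then obtain s' where s': "(s', s) \<in> child_rel" "\<And>t'. (t', t) \<in> child_rel \<Longrightarrow> \<not> le s' t'"
      by (meson leI)
    then have "le t s'" using 1(1)[OF s'(1)] by (meson leI)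
    with s'(1) show ?case by blast
  qed
  then show ?thesis using le_child le_trans by blast
qed

text \<open>The analogue of the center of a finite tree: at every edge the branch ahead,
  \<open>(v, u)\<close>, has rank at most that of the branch behind, \<open>(u, v)\<close>.\<close>

definition center :: "'a set" where
  "center = {v \<in> V. \<forall>u. (v, u) \<in> E \<longrightarrow> le (v, u) (u, v)}"

text \<open>From a non-central vertex one can step into a strictly larger branch. Stepping back at
  once would make each side of an edge strictly larger than the other, against
  \<open>le_total\<close>, so the walk would go on forever.\<close>

lemma center_nonempty: "center \<noteq> {}"
proof
  assume "center = {}"
  then have "\<forall>v. \<exists>u. v \<in> V \<longrightarrow> (v, u) \<in> E \<and> \<not> le (v, u) (u, v)"
    unfolding center_def by blast
  then obtain f where f: "\<And>v. v \<in> V \<Longrightarrow> (v, f v) \<in> E \<and> \<not> le (v, f v) (f v, v)"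
    by metis
  obtain c where c: "c \<in> V" using nonempty by blast
  define r where "r n = (f ^^ n) c" for n
  have V: "r n \<in> V" for n
    by (induction n) (use c f edge_in in \<open>auto simp: r_def\<close>)
  have Suc: "r (Suc n) = f (r n)" for n
    by (simp add: r_def)
  show False
  proof (rule no_infinite_walk[of r])
    show "(r n, r (Suc n)) \<in> E" for n
      using f V Suc by simp
    show "r (Suc (Suc n)) \<noteq> r n" for n
      using f[OF V, of n] f[OF V, of "Suc n"] le_total by (metis Suc)
  qed
qed

text \<open>Along a walk leaving a central vertex the branch ahead becomes ever smaller than the one
  behind.\<close>

lemma not_center_beyond:
  assumes "(s, t) \<in> E" "le (s, t) (t, s)" "x \<in> branch s t" "x \<noteq> t"
  shows "x \<notin> center"
proof -
  have "in_branch s t x \<Longrightarrow> (s, t) \<in> E \<Longrightarrow> le (s, t) (t, s) \<Longrightarrow> x \<noteq> t \<Longrightarrow> x \<notin> center"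
  proof (induction rule: in_branch.induct)
    case (tip u v)
    then show ?case by simp
  next
    case (step t t' s x)
    have 1: "((t, t'), (s, t)) \<in> child_rel"
      using step by (simp add: child_relI children_def)
    have 2: "((t, s), (t', t)) \<in> child_rel"
      using step edge_sym by (auto simp: child_rel_def children_def)
    \<comment> \<open>Otherwise \<open>(t', t)\<close> would be below its own child
      \<open>(t, s)\<close>, by way of \<open>(t, t')\<close> and \<open>(s, t)\<close>.\<close>
    have "\<not> le (t', t) (t, t')"
      using 1 2 step.prems le_child not_le_child le_trans by meson
    then show ?case
      using step le_total edge_sym unfolding center_def by blast
  qed
  then show ?thesis using assms by (simp add: branch_def)
qed

text \<open>By \<open>not_center_beyond\<close> all other central vertices are neighbours of
  \<open>c\<close>, and if there were two, one would lie beyond \<open>c\<close> as seen from the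
  other. A single central vertex is the case \<open>c = d\<close>.\<close>

lemma center_cases:
  obtains c d where "c \<in> V" "d \<in> V" "center = {c, d}"
proof -
  obtain c where c: "c \<in> center" using center_nonempty by blast
  then have cV: "c \<in> V" and le: "\<And>u. (c, u) \<in> E \<Longrightarrow> le (c, u) (u, c)"
    by (auto simp: center_def)
  have nbr: "(c, x) \<in> E" if x: "x \<in> center" "x \<noteq> c" for x
  proof -
    have "x \<in> branch c c" using branch_self[OF cV] x by (simp add: center_def)
    then obtain w where "w \<in> children c c" "x \<in> branch c w"
      using branch_unfold[of c c] x by blast
    then show ?thesis
      using not_center_beyond le x unfolding children_def by blast
  qed
  have "x = y" if xy: "x \<in> center" "x \<noteq> c" "y \<in> center" "y \<noteq> c" for x y
  proof (rule ccontr)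
    assume "x \<noteq> y"
    then have "y \<in> children x c"
      using nbr[of y] xy by (auto simp: children_def)
    then have "y \<in> branch x c" using children_subset_branch by blast
    moreover have "(x, c) \<in> E" using nbr xy edge_sym by blast
    moreover have "le (x, c) (c, x)" using xy \<open>(x, c) \<in> E\<close> by (simp add: center_def)
    ultimately show False using not_center_beyond xy by blast
  qed
  then have "center = {c} \<or> (\<exists>d\<in>V. center = {c, d})"
    using c unfolding center_def by blast
  then show thesis using that cV by blast
qed

section \<open>Automorphisms and the center\<close>

lemma automorphismsD:
  assumes "f \<in> automorphisms V E"
  shows "f permutes V" "bij_betw f V V" "x \<in> V \<Longrightarrow> f x \<in> V"
    "x \<in> V \<Longrightarrow> y \<in> V \<Longrightarrow> (f x, f y) \<in> E \<longleftrightarrow> (x, y) \<in> E"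
  using assms unfolding automorphisms_def
  by (auto simp: permutes_imp_bij permutes_in_image)

lemma automorphism_edge_iff:
  assumes f: "f \<in> automorphisms V E"
  shows "(f x, f y) \<in> E \<longleftrightarrow> (x, y) \<in> E"
  using automorphismsD(1,4)[OF f] edge_in permutes_in_image by metis

text \<open>An equivalence, since transporting a simulation requires both pulling children back and
  pushing them forward.\<close>

lemma automorphism_child_rel:
  assumes f: "f \<in> automorphisms V E"
  shows "(q, map_prod f f s) \<in> child_rel \<longleftrightarrow> (\<exists>p. q = map_prod f f p \<and> (p, s) \<in> child_rel)"
proof -
  have surj: "\<exists>x. y = f x" for y
    using permutes_surj[OF automorphismsD(1)[OF f]] by blast
  have inj: "f x = f y \<longleftrightarrow> x = y" for x y
    using permutes_inj[OF automorphismsD(1)[OF f]] by (auto simp: inj_def)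
  obtain u v where s: "s = (u, v)" by fastforce
  obtain x y where q: "q = (f x, f y)" using surj by (metis prod.collapse)
  show ?thesis
    by (auto simp: s q child_rel_def children_def inj automorphism_edge_iff[OF f])
qed

lemma automorphism_le:
  assumes f: "f \<in> automorphisms V E" and "le s t"
  shows "le (map_prod f f s) (map_prod f f t)"
  using assms(2)
proof induction
  case (leI s t)
  show ?case
  proof (rule le.leI)
    fix q assume "(q, map_prod f f s) \<in> child_rel"
    then obtain p where "q = map_prod f f p" "(p, s) \<in> child_rel"
      using automorphism_child_rel[OF f] by blast
    then show "\<exists>t'. (t', map_prod f f t) \<in> child_rel \<and> le q t'"
      using leI automorphism_child_rel[OF f] by blast
  qed
qed

lemma automorphism_center:
  assumes f: "f \<in> automorphisms V E" and v: "v \<in> center"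
  shows "f v \<in> center"
proof -
  have "le (f v, u) (u, f v)" if "(f v, u) \<in> E" for u
  proof -
    obtain u' where u: "u = f u'"
      using permutes_surj[OF automorphismsD(1)[OF f]] by blast
    then have "le (v, u') (u', v)"
      using v that automorphism_edge_iff[OF f] by (simp add: center_def)
    then show ?thesis using automorphism_le[OF f] u by fastforce
  qed
  then show ?thesis
    using v automorphismsD(3)[OF f] by (simp add: center_def)
qed

subsection \<open>Isomorphisms between branches\<close>

text \<open>Isomorphisms of rooted trees, matching the tips. Outside the branch \<open>g\<close> is
  arbitrary.\<close>

definition iso :: "('a \<Rightarrow> 'a) \<Rightarrow> 'a \<Rightarrow> 'a \<Rightarrow> 'a \<Rightarrow> 'a \<Rightarrow> bool" where
  "iso g u v u' v' \<longleftrightarrow> bij_betw g (branch u v) (branch u' v') \<and> g v = v' \<and>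
     (\<forall>x\<in>branch u v. \<forall>y\<in>branch u v. (g x, g y) \<in> E \<longleftrightarrow> (x, y) \<in> E)"

lemma iso_id: "iso id u v u v"
  by (simp add: iso_def)

lemma iso_inv:
  assumes "iso g u v u' v'"
  shows "iso (inv_into (branch u v) g) u' v' u v"
proof -
  let ?h = "inv_into (branch u v) g"
  have bij: "bij_betw g (branch u v) (branch u' v')" using assms by (simp add: iso_def)
  have "?h v' = v"
    using assms bij tip_in_branch by (metis iso_def bij_betw_inv_into_left)
  moreover have "(?h x, ?h y) \<in> E \<longleftrightarrow> (x, y) \<in> E"
    if "x \<in> branch u' v'" "y \<in> branch u' v'" for x y
    using assms that bij_betwE[OF bij_betw_inv_into[OF bij]] bij_betw_inv_into_right[OF bij]
    unfolding iso_def by metis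
  ultimately show ?thesis
    using bij_betw_inv_into[OF bij] by (simp add: iso_def)
qed

lemma iso_comp:
  assumes "iso g u v u' v'" "iso h u' v' u'' v''"
  shows "iso (h \<circ> g) u v u'' v''"
  using assms bij_betw_trans[of g "branch u v" "branch u' v'" h "branch u'' v''"]
    bij_betwE[of g "branch u v" "branch u' v'"]
  unfolding iso_def by simp

definition node :: "'a \<Rightarrow> 'a \<Rightarrow> bool" where
  "node u v \<longleftrightarrow> (u, v) \<in> E \<or> u = v \<and> v \<in> V"

text \<open>Describes children from within the branch, without the stem \<open>u\<close>, so that
  isomorphisms visibly preserve them.\<close>

lemma children_eq: "node u v \<Longrightarrow> children u v = {w \<in> branch u v. (v, w) \<in> E}"
  using children_subset_branch[of u v] stem_notin_branch[of u v] edge_irrefl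
  by (auto simp: node_def children_def)

text \<open>Injectivity keeps the images of non-backtracking walks from backtracking.\<close>

lemma hom_branch:
  assumes "inj_on g S" "\<And>x y. x \<in> S \<Longrightarrow> y \<in> S \<Longrightarrow> (x, y) \<in> E \<Longrightarrow> (g x, g y) \<in> E"
    and "s \<in> S" "branch s t \<subseteq> S"
  shows "g ` branch s t \<subseteq> branch (g s) (g t)"
proof -
  have "in_branch s t x \<Longrightarrow> s \<in> S \<Longrightarrow> branch s t \<subseteq> S \<Longrightarrow> in_branch (g s) (g t) (g x)" for s t x
  proof (induction rule: in_branch.induct)
    case (tip s t)
    show ?case by (rule in_branch.tip)
  next
    case (step t t' s x)
    then have t': "t' \<in> children s t" by (simp add: children_def)
    have S: "t \<in> S" "t' \<in> S" "branch t t' \<subseteq> S"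
      using step.prems tip_in_branch child_branch_subset[OF t'] by blast+
    then have "g t' \<noteq> g s"
      using assms(1) step by (metis inj_onD)
    then show ?case
      using in_branch.step step S assms(2) by meson
  qed
  then show ?thesis using assms(3,4) by (auto simp: branch_def)
qed

text \<open>Applying \<open>hom_branch\<close> to \<open>g\<close> and to its inverse gives the two
  inclusions between the image of the branch at \<open>w\<close> and the branch at
  \<open>g w\<close>.\<close>

lemma iso_child:
  assumes g: "iso g u v u' v'" and n: "node u v" "node u' v'" and w: "w \<in> children u v"
  shows "g w \<in> children u' v'" "iso g v w v' (g w)"
proof -
  have sub: "branch v w \<subseteq> branch u v" using child_branch_subset[OF w] .
  have bij: "bij_betw g (branch u v) (branch u' v')" and gv: "g v = v'"
    and edge: "\<And>x y. x \<in> branch u v \<Longrightarrow> y \<in> branch u v \<Longrightarrow> (g x, g y) \<in> E \<longleftrightarrow> (x, y) \<in> E"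
    using g by (auto simp: iso_def)
  have wB: "w \<in> branch u v" using sub tip_in_branch by blast
  show gw: "g w \<in> children u' v'"
    using w wB edge[OF tip_in_branch wB] bij_betwE[OF bij] gv
    by (auto simp: children_eq n)
  let ?h = "inv_into (branch u v) g"
  have hg: "\<And>x. x \<in> branch u v \<Longrightarrow> ?h (g x) = x" and gh: "\<And>x. x \<in> branch u' v' \<Longrightarrow> g (?h x) = x"
    using bij by (simp_all add: bij_betw_inv_into_left bij_betw_inv_into_right)
  have h: "iso ?h u' v' u v" using iso_inv[OF g] .
  have 1: "g ` branch v w \<subseteq> branch v' (g w)"
    using hom_branch[of g "branch u v" v w] bij edge sub tip_in_branch gv
    by (auto simp: bij_betw_def)
  have "?h ` branch v' (g w) \<subseteq> branch (?h v') (?h (g w))"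
    using hom_branch[of ?h "branch u' v'" v' "g w"] h child_branch_subset[OF gw] tip_in_branch
    by (auto simp: iso_def bij_betw_def)
  then have 2: "?h ` branch v' (g w) \<subseteq> branch v w"
    using h hg[OF wB] by (simp add: iso_def)
  have "branch v' (g w) \<subseteq> g ` branch v w"
  proof
    fix y assume y: "y \<in> branch v' (g w)"
    then have "g (?h y) = y" using gh child_branch_subset[OF gw] by blast
    then show "y \<in> g ` branch v w" using 2 y by (metis image_eqI image_subset_iff)
  qed
  with 1 have "bij_betw g (branch v w) (branch v' (g w))"
    using bij sub by (metis bij_betw_subset subset_antisym)
  then show "iso g v w v' (g w)"
    using edge sub by (auto simp: iso_def)
qed

lemma automorphism_iso:
  assumes f: "f \<in> automorphisms V E" and c: "c \<in> V" "f c = c"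
  shows "iso f c c c c"
  using automorphismsD[OF f] c by (simp add: iso_def branch_self)

text \<open>Exchange the branches by \<open>g\<close> and its inverse and fix everything else. The
  only edges leaving them join the tips to \<open>v\<close>, and these are swapped. This gives the
  motion its grip on isomorphic siblings.\<close>

lemma sibling_swap:
  assumes w: "(v, w) \<in> E" "(v, w') \<in> E" "w \<noteq> w'" and g: "iso g v w v w'"
  shows "\<exists>f\<in>automorphisms V E. {x \<in> V. f x \<noteq> x} = branch v w \<union> branch v w'"
proof -
  let ?A = "branch v w" and ?B = "branch v w'" and ?h = "inv_into (branch v w) g"
  have disj: "?A \<inter> ?B = {}" using sibling_branches_disjoint[OF w] .
  have bij: "bij_betw g ?A ?B" and gw: "g w = w'"
    and edge: "\<And>x y. x \<in> ?A \<Longrightarrow> y \<in> ?A \<Longrightarrow> (g x, g y) \<in> E \<longleftrightarrow> (x, y) \<in> E"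
    using g by (auto simp: iso_def)
  have h: "iso ?h v w' v w" using iso_inv[OF g] .
  have hw: "?h w' = w"
    and hedge: "\<And>x y. x \<in> ?B \<Longrightarrow> y \<in> ?B \<Longrightarrow> (?h x, ?h y) \<in> E \<longleftrightarrow> (x, y) \<in> E"
    using h by (auto simp: iso_def)
  have gB: "\<And>x. x \<in> ?A \<Longrightarrow> g x \<in> ?B" using bij bij_betwE by blast
  have hA: "\<And>x. x \<in> ?B \<Longrightarrow> ?h x \<in> ?A" using h bij_betwE unfolding iso_def by blast
  have hg: "\<And>x. x \<in> ?A \<Longrightarrow> ?h (g x) = x" and gh: "\<And>x. x \<in> ?B \<Longrightarrow> g (?h x) = x"
    using bij by (simp_all add: bij_betw_inv_into_left bij_betw_inv_into_right)
  have vA: "v \<notin> ?A" "v \<notin> ?B" using stem_notin_branch w by blast+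
  define f where "f x = (if x \<in> ?A then g x else if x \<in> ?B then ?h x else x)" for x
  have fA: "\<And>x. x \<in> ?A \<Longrightarrow> f x = g x" and fB: "\<And>x. x \<in> ?B \<Longrightarrow> f x = ?h x"
    and fC: "\<And>x. x \<notin> ?A \<Longrightarrow> x \<notin> ?B \<Longrightarrow> f x = x"
    using disj by (auto simp: f_def)
  have ff: "f (f x) = x" for x
    using gB hA hg gh fA fB fC by metis
  have AV: "?A \<subseteq> V" "?B \<subseteq> V" using branch_subset edge_in w by blast+
  have "f permutes V"
    unfolding permutes_def using AV fC ff by (metis subsetD)
  have out: "(f x, f y) \<in> E" if xy: "(x, y) \<in> E" "x \<in> ?A \<union> ?B" for x y
  proof -
    consider "x \<in> ?A" "y \<in> ?A" | "x \<in> ?B" "y \<in> ?B" | "x \<in> ?A" "y \<notin> ?A" | "x \<in> ?B" "y \<notin> ?B"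
      using xy by blast
    then show ?thesis
    proof cases
      case 1 then show ?thesis using xy edge fA by simp
    next
      case 2 then show ?thesis using xy hedge fB by simp
    next
      case 3
      then have "x = w" "y = v" using branch_exit xy by blast+
      then show ?thesis using fA[OF tip_in_branch] gw fC vA w edge_sym by simp
    next
      case 4
      then have "x = w'" "y = v" using branch_exit xy by blast+
      then show ?thesis using fB[OF tip_in_branch] hw fC vA w edge_sym by simp
    qed
  qed
  have fE: "(f x, f y) \<in> E" if "(x, y) \<in> E" for x y
    using that out[of x y] out[of y x] edge_sym fC by (metis UnI1 UnI2)
  \<comment> \<open>As \<open>f\<close> is an involution, preserving edges in one direction
    suffices.\<close>
  have "f \<in> automorphisms V E"
    using \<open>f permutes V\<close> fE fE[of "f _" "f _"] unfolding automorphisms_def ff by blast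
  moreover have "{x \<in> V. f x \<noteq> x} = ?A \<union> ?B"
  proof -
    have "f x \<noteq> x" if "x \<in> ?A" for x using fA gB disj that by fastforce
    moreover have "f x \<noteq> x" if "x \<in> ?B" for x using fB hA disj that by fastforce
    ultimately show ?thesis using AV fC by blast
  qed
  ultimately show ?thesis by blast
qed

subsection \<open>Asymmetrizing codes of branches\<close>

text \<open>For \<open>A = A'\<close> the second clause makes \<open>\<Phi> A\<close> asymmetrizing, for \<open>A \<noteq> A'\<close> it makes \<open>\<Phi> A\<close>
  and \<open>\<Phi> A'\<close> inequivalent.\<close>

definition is_code :: "'a \<Rightarrow> 'a \<Rightarrow> ('a set \<Rightarrow> 'a set) \<Rightarrow> bool" where
  "is_code u v \<Phi> \<longleftrightarrow> (\<forall>A\<subseteq>branch u v. \<Phi> A \<subseteq> branch u v) \<and>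
     (\<forall>A A' f. A \<subseteq> branch u v \<longrightarrow> A' \<subseteq> branch u v \<longrightarrow> iso f u v u v \<longrightarrow> f ` \<Phi> A = \<Phi> A' \<longrightarrow>
        A = A' \<and> (\<forall>x\<in>branch u v. f x = x))"

lemma is_codeD:
  assumes "is_code u v \<Phi>" "A \<subseteq> branch u v"
  shows "\<Phi> A \<subseteq> branch u v"
    and "A' \<subseteq> branch u v \<Longrightarrow> iso f u v u v \<Longrightarrow> f ` \<Phi> A = \<Phi> A' \<Longrightarrow> A = A'"
    and "A' \<subseteq> branch u v \<Longrightarrow> iso f u v u v \<Longrightarrow> f ` \<Phi> A = \<Phi> A' \<Longrightarrow> x \<in> branch u v \<Longrightarrow> f x = x"
  using assms unfolding is_code_def by simp_all

text \<open>Identify every child branch with a representative \<open>j\<close> of its isomorphism class. The code of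
  \<open>A\<close> puts on the branch at \<open>w\<close> the code of a subset of the branch at \<open>j\<close> encoding both \<open>w\<close> and
  the trace of \<open>A\<close>; the former keeps isomorphic siblings apart.\<close>

lemma is_code_step:
  assumes n: "node u v"
    and codes: "\<And>w. w \<in> children u v \<Longrightarrow> \<exists>\<Phi>. is_code v w \<Phi>"
    and room: "\<And>j. j \<in> children u v \<Longrightarrow>
      \<exists>h. inj_on h ({w \<in> children u v. \<exists>g. iso g v j v w} \<times> Pow (branch v j)) \<and>
          h ` ({w \<in> children u v. \<exists>g. iso g v j v w} \<times> Pow (branch v j)) \<subseteq> Pow (branch v j)"
  shows "\<exists>\<Phi>. is_code u v \<Phi>"
proof -
  let ?C = "children u v" and ?D = "branch v"
  define K where "K j = {w \<in> ?C. \<exists>g. iso g v j v w}" for j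
  define rep where "rep w = (SOME j. j \<in> ?C \<and> (\<exists>g. iso g v j v w))" for w
  have rep: "rep w \<in> ?C \<and> (\<exists>g. iso g v (rep w) v w)" if "w \<in> ?C" for w
    unfolding rep_def by (rule someI[of _ w]) (use that iso_id in blast)
  \<comment> \<open>Isomorphic siblings define the same predicate on \<open>j\<close>, so
    \<open>SOME\<close> picks the same representative.\<close>
  have rep_eq: "rep w = rep w'" if "iso g v w v w'" for w w' g
  proof -
    have "(\<exists>g. iso g v j v w) \<longleftrightarrow> (\<exists>g. iso g v j v w')" for j
      using that iso_comp iso_inv by meson
    then show ?thesis by (simp add: rep_def)
  qed
  obtain g where g: "\<And>w. w \<in> ?C \<Longrightarrow> iso (g w) v (rep w) v w"
    using rep by metis
  obtain \<Phi> where \<Phi>: "\<And>w. w \<in> ?C \<Longrightarrow> is_code v w (\<Phi> w)"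
    using codes by metis
  have "\<forall>j. \<exists>h. j \<in> ?C \<longrightarrow> inj_on h (K j \<times> Pow (?D j)) \<and> h ` (K j \<times> Pow (?D j)) \<subseteq> Pow (?D j)"
    using room unfolding K_def by blast
  then obtain h where h: "\<And>j. j \<in> ?C \<Longrightarrow> inj_on (h j) (K j \<times> Pow (?D j))"
    "\<And>j. j \<in> ?C \<Longrightarrow> h j ` (K j \<times> Pow (?D j)) \<subseteq> Pow (?D j)"
    by metis
  have K: "w \<in> K (rep w)" if "w \<in> ?C" for w
    using rep[OF that] that by (simp add: K_def)
  \<comment> \<open>\<open>Y\<close> pulls the trace of \<open>A\<close> back to the representative,
    \<open>Z\<close> packs it together with the name \<open>w\<close> into one subset there, and
    \<open>P\<close> carries the code of that subset to the branch at \<open>w\<close>. The tip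
    \<open>v\<close>, outside all child branches, records its own membership.\<close>
  define Y where "Y A w = {x \<in> ?D (rep w). g w x \<in> A}" for A w
  define Z where "Z A w = h (rep w) (w, Y A w)" for A w
  define P where "P A w = g w ` \<Phi> (rep w) (Z A w)" for A w
  define \<Psi> where "\<Psi> A = (A \<inter> {v}) \<union> (\<Union>w\<in>?C. P A w)" for A
  have Y: "Y A w \<subseteq> ?D (rep w)" for A w by (auto simp: Y_def)
  have Z: "Z A w \<subseteq> ?D (rep w)" if "w \<in> ?C" for A w
    using h(2)[of "rep w"] rep[OF that] K[OF that] Y[of A w] unfolding Z_def by blast
  have P: "P A w \<subseteq> ?D w" if "w \<in> ?C" for A w
    using is_codeD(1)[OF \<Phi> Z] rep[OF that] that g[OF that]
    unfolding P_def iso_def bij_betw_def by blast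
  have vD: "v \<notin> ?D w" if "w \<in> ?C" for w
    using that stem_notin_branch by (auto simp: children_def)
  have disj: "?D w \<inter> ?D w' = {}" if "w \<in> ?C" "w' \<in> ?C" "w \<noteq> w'" for w w'
    using that sibling_branches_disjoint by (auto simp: children_def)
  have \<Psi>D: "\<Psi> A \<inter> ?D w = P A w" if "w \<in> ?C" for A w
    using P[OF that] P disj[OF that] vD[OF that] that unfolding \<Psi>_def by blast
  have \<Psi>v: "v \<in> \<Psi> A \<longleftrightarrow> v \<in> A" for A
    using P vD unfolding \<Psi>_def by blast
  have "is_code u v \<Psi>"
    unfolding is_code_def
  proof (intro conjI allI impI)
    fix A assume "A \<subseteq> branch u v"
    then show "\<Psi> A \<subseteq> branch u v"
      unfolding \<Psi>_def using P child_branch_subset by blast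
  next
    fix A A' f
    assume A: "A \<subseteq> branch u v" "A' \<subseteq> branch u v" and f: "iso f u v u v" and eq: "f ` \<Psi> A = \<Psi> A'"
    have \<Psi>B: "\<Psi> A \<subseteq> branch u v" "\<Psi> A' \<subseteq> branch u v"
      unfolding \<Psi>_def using A P child_branch_subset by blast+
    have inj: "inj_on f (branch u v)" and fv: "f v = v"
      using f by (auto simp: iso_def bij_betw_def)
    have vA: "v \<in> A \<longleftrightarrow> v \<in> A'"
      using inj_on_image_mem_iff[OF inj tip_in_branch \<Psi>B(1)] fv eq \<Psi>v by metis
    have child: "A \<inter> ?D w = A' \<inter> ?D w \<and> (\<forall>x\<in>?D w. f x = x)" if w: "w \<in> ?C" for w
    proof -
      let ?w = "f w" and ?j = "rep w"
      have w': "?w \<in> ?C" and fw: "iso f v w v ?w" using iso_child[OF f n n w] by auto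
      have j: "rep ?w = ?j" "?j \<in> ?C" using rep_eq[OF fw] rep[OF w] by auto
      have bg: "bij_betw (g w) (?D ?j) (?D w)" "bij_betw (g ?w) (?D ?j) (?D ?w)"
        using g[OF w] g[OF w'] j by (auto simp: iso_def)
      have img: "f ` P A w = P A' ?w"
      proof -
        have "f ` (\<Psi> A \<inter> ?D w) = f ` \<Psi> A \<inter> f ` ?D w"
          using inj_on_image_Int[OF inj \<Psi>B(1) child_branch_subset[OF w]] .
        also have "f ` ?D w = ?D ?w" using fw by (simp add: iso_def bij_betw_def)
        finally show ?thesis using eq \<Psi>D w w' by simp
      qed
      \<comment> \<open>From the representative to \<open>w\<close>, along \<open>f\<close>, and
        back again: an automorphism of the branch at \<open>?j\<close>, to which the code there
        applies.\<close>
      define k where "k = inv_into (?D ?j) (g ?w) \<circ> (f \<circ> g w)"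
      have k: "iso k v ?j v ?j"
        unfolding k_def using iso_comp[OF iso_comp[OF g[OF w] fw] iso_inv[OF g[OF w', unfolded j]]] .
      have "k ` \<Phi> ?j (Z A w) = inv_into (?D ?j) (g ?w) ` f ` P A w"
        by (simp add: k_def P_def image_comp comp_assoc)
      also have "\<dots> = inv_into (?D ?j) (g ?w) ` P A' ?w"
        by (simp only: img)
      also have "\<dots> = \<Phi> ?j (Z A' ?w)"
        using is_codeD(1)[OF \<Phi>[OF j(2)], of "Z A' ?w"] Z[OF w', of A'] bg(2) j
        by (simp add: P_def bij_betw_def)
      finally have "k ` \<Phi> ?j (Z A w) = \<Phi> ?j (Z A' ?w)" .
      note code = is_codeD(2,3)[OF \<Phi>[OF j(2)] Z[OF w] Z[OF w', unfolded j(1)] k this]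
      have Zeq: "Z A w = Z A' ?w" by (rule code(1))
      have kid: "\<And>x. x \<in> ?D ?j \<Longrightarrow> k x = x" by (rule code(2))
      \<comment> \<open>Injectivity of \<open>h\<close> recovers both the name and the trace:
        \<open>f\<close> fixes the child \<open>w\<close>, and \<open>A\<close> and
        \<open>A'\<close> agree on its branch.\<close>
      have "h ?j (w, Y A w) = h ?j (?w, Y A' ?w)"
        using Zeq by (simp only: Z_def j(1))
      moreover have "(w, Y A w) \<in> K ?j \<times> Pow (?D ?j)" "(?w, Y A' ?w) \<in> K ?j \<times> Pow (?D ?j)"
        using K[OF w] K[OF w'] Y[of A w] Y[of A' ?w] unfolding j(1) by blast+
      ultimately have "(w, Y A w) = (?w, Y A' ?w)"
        by (rule inj_onD[OF h(1)[OF j(2)]])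
      then have ww: "?w = w" and YY: "Y A w = Y A' w" by auto
      have fx: "f x = x" if x: "x \<in> ?D w" for x
      proof -
        obtain y where y: "y \<in> ?D ?j" "x = g w y"
          using x bg(1) by (auto simp: bij_betw_def)
        have "f x \<in> ?D w" using x fw ww by (auto simp: iso_def bij_betw_def)
        then have "g w (k y) = f x"
          using bg(2) ww y by (simp add: k_def bij_betw_inv_into_right)
        then show ?thesis using kid y by simp
      qed
      have "x \<in> A \<longleftrightarrow> x \<in> A'" if x: "x \<in> ?D w" for x
      proof -
        obtain y where y: "y \<in> ?D ?j" "x = g w y"
          using x bg(1) by (auto simp: bij_betw_def)
        then show ?thesis using YY unfolding Y_def by blast
      qed
      then show ?thesis using fx by blast
    qed
    have cover: "x = v \<or> (\<exists>w\<in>?C. x \<in> ?D w)" if "x \<in> branch u v" for x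
      using that branch_unfold[of u v] by blast
    have "x \<in> A \<longleftrightarrow> x \<in> A'" if "x \<in> branch u v" for x
      using cover[OF that] vA child by blast
    then show "A = A'" using A by blast
    show "\<forall>x\<in>branch u v. f x = x"
      using cover fv child by blast
  qed
  then show ?thesis by blast
qed

lemma codes_exist:
  assumes "node u v"
    and room: "\<And>u v j. node u v \<Longrightarrow> j \<in> children u v \<Longrightarrow>
      \<exists>h. inj_on h ({w \<in> children u v. \<exists>g. iso g v j v w} \<times> Pow (branch v j)) \<and>
          h ` ({w \<in> children u v. \<exists>g. iso g v j v w} \<times> Pow (branch v j)) \<subseteq> Pow (branch v j)"
  shows "\<exists>\<Phi>. is_code u v \<Phi>"
  using assms(1)
proof (induction "(u, v)" arbitrary: u v rule: wf_induct_rule[OF wf_child_rel])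
  case 1
  show ?case
  proof (rule is_code_step[OF 1(2) _ room[OF 1(2)]])
    fix w assume w: "w \<in> children u v"
    then have "node v w" by (simp add: node_def children_def)
    with 1(1)[OF child_relI[OF w]] show "\<exists>\<Phi>. is_code v w \<Phi>" .
  qed
qed

subsection \<open>Motion and degrees\<close>

lemma motion_le:
  assumes "has_motion V E m" "f \<in> automorphisms V E" "{x \<in> V. f x \<noteq> x} = M" "M \<noteq> {}"
  shows "m \<le>o |M|"
  using assms unfolding has_motion_def by fastforce

text \<open>If \<open>j\<close> has no isomorphic sibling, projection to the second component will
  do. Otherwise swapping two siblings shows that the branch has at least \<open>m\<close> vertices;
  by the degree bound there are at most \<open>2^m\<close> siblings, a factor that the infinite
  power set of the branch absorbs.\<close>

lemma room_for_children:
  fixes m :: "'b rel"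
  assumes m: "Card_order m" "cinfinite m" and motion: "has_motion V E m"
    and deg: "sup_degree V E \<le>o ctwo ^c m"
    and n: "node u v" and j: "j \<in> children u v"
  shows "\<exists>h. inj_on h ({w \<in> children u v. \<exists>g. iso g v j v w} \<times> Pow (branch v j)) \<and>
    h ` ({w \<in> children u v. \<exists>g. iso g v j v w} \<times> Pow (branch v j)) \<subseteq> Pow (branch v j)"
proof -
  let ?K = "{w \<in> children u v. \<exists>g. iso g v j v w}" and ?D = "branch v j"
  have "|?K \<times> Pow ?D| \<le>o |Pow ?D|"
  proof (cases "?K \<subseteq> {j}")
    case True
    then have "?K \<times> Pow ?D \<subseteq> {j} \<times> UNIV" by blast
    moreover have "inj_on snd ({j} \<times> UNIV)" by (auto intro: inj_onI)
    ultimately have "inj_on snd (?K \<times> Pow ?D)" by (rule inj_on_subset[rotated])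
    then show ?thesis
      by (rule card_of_ordLeqI) auto
  next
    case False
    then obtain w g where w: "w \<in> children u v" "w \<noteq> j" and g: "iso g v j v w" by blast
    have "|?D| =o |branch v w|"
      using g card_of_ordIso unfolding iso_def by blast
    then have eq: "|branch v w| \<le>o |?D|" "finite ?D \<longleftrightarrow> finite (branch v w)"
      using ordIso_symmetric ordIso_imp_ordLeq card_of_ordIso_finite by blast+
    obtain f where "f \<in> automorphisms V E" "{x \<in> V. f x \<noteq> x} = ?D \<union> branch v w"
      using sibling_swap[OF _ _ _ g] j w by (auto simp: children_def)
    then have mo: "m \<le>o |?D \<union> branch v w|"
      using motion_le[OF motion] tip_in_branch by blast
    from cinfinite_mono[OF this m(2)] have "infinite (?D \<union> branch v w)"
      by (simp add: cinfinite_def Field_card_of)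
    then have inf: "infinite ?D" using eq by simp
    then have "|?D \<union> branch v w| \<le>o |?D|"
      using card_of_Un_ordLeq_infinite_Field[OF _ card_of_mono1[OF order.refl] eq(1) card_of_Card_order]
      by (simp add: Field_card_of)
    with mo have mD: "m \<le>o |?D|" by (rule ordLeq_transitive)
    have "?K \<subseteq> E `` {v}" by (auto simp: children_def)
    moreover have "v \<in> V" using j edge_in by (auto simp: children_def)
    ultimately have "|?K| \<le>o sup_degree V E"
      using sup_degree_upper[of V E] card_of_mono1 ordLeq_transitive
      unfolding degree_bound_def by blast
    also note deg
    also have "ctwo ^c m \<le>o ctwo ^c |?D|"
      using cexp_mono2_Cnotzero[OF mD Card_order_ctwo] Cinfinite_Cnotzero m by blast
    also have "ctwo ^c |?D| =o |Pow ?D|"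
      using card_of_Pow_Func ordIso_symmetric unfolding ctwo_def cexp_def Field_card_of by blast
    finally have K: "|?K| \<le>o |Pow ?D|" .
    show ?thesis
      using card_of_Times_ordLeq_infinite_Field[OF _ K card_of_mono1[OF order.refl] card_of_Card_order]
        inf by (simp add: Field_card_of)
  qed
  then show ?thesis unfolding card_of_ordLeq[symmetric] .
qed

text \<open>Since automorphisms preserve the center \<open>{c, d}\<close>, those mapping a set that contains \<open>c\<close>
  but not \<open>d\<close> to another such set fix \<open>c\<close>.\<close>

lemma marked_code_automorphism:
  assumes c: "c \<in> V" "d \<in> V" "center = {c, d}" and code: "is_code c c \<Phi>"
    and A: "A \<subseteq> V" "A' \<subseteq> V" and f: "f \<in> automorphisms V E"
    and eq: "f ` insert c (\<Phi> A - {d}) = insert c (\<Phi> A' - {d})"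
    and trace: "\<Phi> A \<inter> {c, d} = \<Phi> A' \<inter> {c, d}"
  shows "A = A'" "f = id"
proof -
  have B: "branch c c = V" using branch_self c by blast
  have inj: "inj f" using automorphismsD(1)[OF f] by (rule permutes_inj)
  have cd: "f c \<in> {c, d}" "f d \<in> {c, d}" using automorphism_center[OF f] c(3) by auto
  \<comment> \<open>If \<open>c\<close> moved to \<open>d\<close>, then \<open>d\<close> would lie
    in the image, from which it was removed.\<close>
  moreover have "f c \<noteq> d \<or> c = d" using eq by (metis Diff_iff image_insert insertCI insertE)
  ultimately have fc: "f c = c" by auto
  have fd: "f d = d" using cd fc inj by (auto simp: inj_eq)
  have iso: "iso f c c c c" using automorphism_iso[OF f c(1) fc] .
  \<comment> \<open>The marking alters only \<open>c\<close> and \<open>d\<close>, which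
    \<open>f\<close> fixes. Away from them the codes correspond, and on them \<open>trace\<close>
    makes the codes agree.\<close>
  have core: "f ` (\<Phi> A - {c, d}) = \<Phi> A' - {c, d}"
  proof -
    have "f ` (insert c (\<Phi> A - {d}) - {c, d}) = insert c (\<Phi> A' - {d}) - {c, d}"
      unfolding image_set_diff[OF inj] eq using fc fd by simp
    moreover have "insert c (X - {d}) - {c, d} = X - {c, d}" for X by auto
    ultimately show ?thesis by simp
  qed
  have img: "f ` (X \<inter> {c, d}) = X \<inter> {c, d}" for X
    using fc fd by (subst image_cong[where g = id]) auto
  have eq': "f ` \<Phi> A = \<Phi> A'"
  proof -
    have "f ` \<Phi> A = f ` (\<Phi> A - {c, d}) \<union> f ` (\<Phi> A \<inter> {c, d})" by blast
    also have "\<dots> = (\<Phi> A' - {c, d}) \<union> (\<Phi> A' \<inter> {c, d})" unfolding core img trace ..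
    finally show ?thesis by blast
  qed
  show "A = A'" using is_codeD(2)[OF code _ _ iso eq'] A B by simp
  have "f x = x" if "x \<in> V" for x
    using is_codeD(3)[OF code _ _ iso eq'] A B that by simp
  then show "f = id"
    using permutes_not_in[OF automorphismsD(1)[OF f]] by (metis eq_id_iff)
qed

section \<open>Counting classes of asymmetrizing sets\<close>

lemma id_automorphism: "id \<in> automorphisms V E"
  by (simp add: automorphisms_def)

text \<open>The marking forgets the trace of the code on \<open>{c, d}\<close>; pairing the class
  with this trace restores injectivity. The trace takes at most four values, a factor that the
  necessarily infinite quotient absorbs.\<close>

lemma card_asymmetrizing_ge:
  assumes V: "infinite V" and c: "c \<in> V" "d \<in> V" "center = {c, d}" and code: "is_code c c \<Phi>"
  shows "|Pow V| \<le>o num_asymmetrizing V E"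
proof -
  let ?R = "asymmetrizing_equiv V E" and ?Q = "asymmetrizing_sets V E // asymmetrizing_equiv V E"
  define S where "S A = insert c (\<Phi> A - {d})" for A
  have S: "S A \<in> asymmetrizing_sets V E" if "A \<subseteq> V" for A
  proof -
    have "\<Phi> A \<subseteq> V" using is_codeD(1)[OF code, of A] that branch_self c by auto
    then have "S A \<subseteq> V" using c by (auto simp: S_def)
    then show ?thesis
      using marked_code_automorphism(2)[OF c code that that]
      unfolding asymmetrizing_sets_def S_def by simp
  qed
  let ?F = "\<lambda>A. (?R `` {S A}, \<Phi> A \<inter> {c, d})"
  have "inj_on ?F (Pow V)"
  proof (rule inj_onI)
    fix A A' assume A: "A \<in> Pow V" "A' \<in> Pow V" and eq: "?F A = ?F A'"
    have "S A' \<in> asymmetrizing_sets V E" "id ` S A' = S A'" using S A by auto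
    then have "(S A', S A') \<in> ?R"
      using id_automorphism unfolding asymmetrizing_equiv_def by blast
    then have "(S A, S A') \<in> ?R" using eq by blast
    then obtain f where "f \<in> automorphisms V E" "f ` S A = S A'"
      by (auto simp: asymmetrizing_equiv_def)
    then show "A = A'"
      using marked_code_automorphism(1)[OF c code, of A A' f] A eq unfolding S_def by simp
  qed
  moreover have "?F ` Pow V \<subseteq> ?Q \<times> Pow {c, d}"
    using S by (auto simp: quotient_def)
  ultimately have le: "|Pow V| \<le>o |?Q \<times> Pow {c, d}|"
    unfolding card_of_ordLeq[symmetric] by blast
  from card_of_ordLeq_infinite[OF this] have "infinite (?Q \<times> Pow {c, d})"
    using V by (simp only: finite_Pow_iff not_False_eq_True)
  then have inf: "infinite ?Q" using finite_cartesian_product[of ?Q "Pow {c, d}"] by auto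
  have "|Pow {c, d}| \<le>o |?Q|"
    using inf by (intro ordLess_imp_ordLeq finite_ordLess_infinite card_of_Well_order)
      (simp_all add: Field_card_of)
  then have "|?Q \<times> Pow {c, d}| =o |?Q|"
    using inf by (intro card_of_Times_infinite_simps) auto
  with le show ?thesis
    unfolding num_asymmetrizing_def using ordLeq_ordIso_trans by blast
qed

end

theorem theorem3p1:
  fixes V :: "'a set" and E :: "'a rel" and m :: "'b rel"
  assumes "Card_order m" and "cinfinite m"
    and "rayless_tree V E"
    and "has_motion V E m"
    and "sup_degree V E \<le>o ctwo ^c m"
  shows "num_asymmetrizing V E =o ctwo ^c |V|"
proof -
  interpret rayless V E by standard (rule assms(3))
  obtain c d where c: "c \<in> V" "d \<in> V" "center = {c, d}" using center_cases .
  obtain \<Phi> where code: "is_code c c \<Phi>"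
    using codes_exist[of c c, OF _ room_for_children[OF assms(1,2,4,5)]] c(1)
    by (auto simp: node_def)
  \<comment> \<open>An automorphism attaining the motion moves \<open>m\<close> vertices, so the
    tree is infinite.\<close>
  obtain f where "|{v \<in> V. f v \<noteq> v}| =o m"
    using assms(4) unfolding has_motion_def by blast
  moreover have "|{v \<in> V. f v \<noteq> v}| \<le>o |V|" by (rule card_of_mono1) blast
  ultimately have "m \<le>o |V|" using ordIso_symmetric ordIso_ordLeq_trans by blast
  from cinfinite_mono[OF this assms(2)] have "infinite V"
    by (simp add: cinfinite_def Field_card_of)
  then have ge: "|Pow V| \<le>o num_asymmetrizing V E"
    using card_asymmetrizing_ge c code by blast
  \<comment> \<open>Upper bound: the classes are an image of a family of subsets of
    \<open>V\<close>.\<close>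
  have "num_asymmetrizing V E \<le>o |asymmetrizing_sets V E|"
    unfolding num_asymmetrizing_def proj_image[symmetric] by (rule card_of_image)
  also have "|asymmetrizing_sets V E| \<le>o |Pow V|"
    by (rule card_of_mono1) (auto simp: asymmetrizing_sets_def)
  finally have "num_asymmetrizing V E =o |Pow V|"
    using ge by (simp add: ordIso_iff_ordLeq)
  also have "|Pow V| =o ctwo ^c |V|"
    using card_of_Pow_Func unfolding ctwo_def cexp_def Field_card_of by blast
  finally show ?thesis .
qed

end
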